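(* Let $d\geq 2$ be an integer, let $G$ be an abelian group, and let $A_1, \dots, A_d$ be finite, non-empty subsets of $G$. Then \[ |A_1 + \dots + A_d| \geq \big(|d A_1| \cdots |d A_d|\big)^{1/(2d)}. \]
   Context: The group operation of $G$ is written additively, and $|Z|$ denotes the cardinality of a finite set $Z$. For finite, non-empty sets $A_1, \dots, A_d \subseteq G$, the sumsets are \[ A_1 + \dots + A_d = \{ a_1 + \dots + a_d: a_i \in A_i \ (1\leq i \leq d)\} \quad \text{and} \quad dA_i = \{a_1 + \dots + a_d : a_1, \dots, a_d \in A_i \}; \] thus $dA_i$ is the $d$-fold sumset of $A_i$ with itself (not a dilate of $A_i$). *)

theory Defs
  imports Complex_Main "HOL-Library.Set_Algebras"
begin

text \<open>
  Addition of sets is the pointwise addition of \<^theory>\<open>HOL-Library.Set_Algebras\<close>. It makes sets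
  over a commutative monoid a commutative monoid with neutral element \<open>{0}\<close>, so the big operator
  \<open>\<Sum>\<close> applied to a family of sets is its sumset (not the sum of its elements), and a sum of \<open>d\<close>
  copies of one set is its \<open>d\<close>-fold sumset:
\<close>

lemma sumset_family:
  fixes A :: "nat \<Rightarrow> 'a::ab_group_add set" and d :: nat
  shows "(\<Sum>i=1..d. A i) = {\<Sum>i=1..d. a i |a. \<forall>i\<in>{1..d}. a i \<in> A i}"
  by (simp add: set_sum_alt)

lemma sumset_iterated:
  fixes B :: "'a::ab_group_add set" and d :: nat
  shows "(\<Sum>i=1..d. B) = {\<Sum>i=1..d. b i |b. \<forall>i\<in>{1..d}. b i \<in> B}"
  by (rule sumset_family)

end

theory Submission
  imports Defs "HOL-Analysis.Convex" "HOL-Library.FuncSet" "HOL-Library.Nat_Bijection"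
begin

text \<open>
  Write \<open>S\<close> for the full sumset and \<open>B i\<close> for the sumset of all \<open>A j\<close> with \<open>j \<noteq> i\<close>, so that
  \<open>S = A i + B i\<close>. Pluennecke's inequality, in Petridis' form, bounds the \<open>d\<close>-fold sumset of \<open>A i\<close>:
  its size times \<open>|B i|^(d - 1)\<close> is at most \<open>|S|^d\<close>. In the other direction
  \<open>|S|^(d - 1) \<le> \<Prod>i. |B i|\<close> (Gyarmati, Matolcsi and Ruzsa), by applying the Loomis--Whitney
  inequality to a set of canonical representations of the elements of \<open>S\<close>. Multiplying the first
  bound over all \<open>i\<close> and inserting the second leaves the exponent \<open>d^2 - (d - 1)^2 = 2 d - 1\<close>.
\<close>

section \<open>Pluennecke's inequality\<close>

lemma set_plus_nonempty: "A \<noteq> {} \<Longrightarrow> B \<noteq> {} \<Longrightarrow> A + B \<noteq> {}"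
  for A B :: "'a::ab_group_add set"
  by (auto simp: set_plus_def)

lemma finite_set_sum:
  fixes A :: "'i \<Rightarrow> 'a::ab_group_add set"
  assumes "\<And>i. i \<in> I \<Longrightarrow> finite (A i)"
  shows "finite (\<Sum>i\<in>I. A i)"
  using assms by (induction I rule: infinite_finite_induct) (auto intro: finite_set_plus)

lemma set_sum_nonempty:
  fixes A :: "'i \<Rightarrow> 'a::ab_group_add set"
  assumes "\<And>i. i \<in> I \<Longrightarrow> A i \<noteq> {}"
  shows "(\<Sum>i\<in>I. A i) \<noteq> {}"
  using assms by (induction I rule: infinite_finite_induct) (auto simp: set_plus_nonempty)

lemma card_le_card_set_plus:
  fixes A B :: "'a::ab_group_add set"
  assumes "finite A" "finite B" "A \<noteq> {}"
  shows "card B \<le> card (A + B)"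
proof -
  obtain a where "a \<in> A" using assms by blast
  then have "{a} + B \<subseteq> A + B" by (intro set_plus_mono2) auto
  then have "B + {a} \<subseteq> A + B" by (simp only: add.commute)
  then have "card (B + {a}) \<le> card (A + B)"
    by (intro card_mono) (simp_all add: finite_set_plus assms)
  then show ?thesis by (simp add: card_plus_sing)
qed

text \<open>Induction on \<open>C\<close>, adding one element \<open>c\<close> at a time. The
  assumption \<open>min\<close> is cross-multiplied: no nonempty subset \<open>Z\<close> of
  \<open>X\<close> has a smaller ratio |Z + A| / |Z| than \<open>X\<close> has. This balances the
  growth of \<open>X + A + C\<close> against that of \<open>X + C\<close>.\<close>

lemma petridis_inequality:
  fixes X A C :: "'a::ab_group_add set"
  assumes fin: "finite X" "finite A" and "finite C"
    and min: "\<And>Z. Z \<subseteq> X \<Longrightarrow> card (X + A) * card Z \<le> card (Z + A) * card X"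
  shows "card (X + A + C) * card X \<le> card (X + A) * card (X + C)"
  using \<open>finite C\<close>
proof (induction C)
  case empty
  show ?case by simp
next
  case (insert c C)
  \<comment> \<open>These are the points of \<open>X\<close> from which \<open>c\<close> yields
    nothing new: their translate of \<open>A + {c}\<close> is already covered.\<close>
  define Z where "Z = {x \<in> X. {x} + A + {c} \<subseteq> X + A + C}"
  have ZX: "Z \<subseteq> X" by (auto simp: Z_def)
  have finZ: "finite Z" using ZX fin(1) finite_subset by blast
  have ins: "insert c C = C \<union> {c}" by blast
  have fXAC: "finite (X + A + C)" and fXC: "finite (X + C)"
    and fXAc: "finite (X + A + {c})" and fXc: "finite (X + {c})"
    and fZAc: "finite (Z + A + {c})" and fZc: "finite (Z + {c})"
    using insert.hyps(1) fin finZ by (auto intro!: finite_set_plus)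
  have sub1: "Z + A + {c} \<subseteq> X + A + {c}" "Z + {c} \<subseteq> X + {c}"
    using ZX by (auto simp: set_plus_def)
  have inZ: "Z + A + {c} \<subseteq> X + A + C"
  proof
    fix y assume "y \<in> Z + A + {c}"
    then obtain z a where "z \<in> Z" "a \<in> A" "y = z + a + c"
      by (auto simp: set_plus_def)
    then show "y \<in> X + A + C"
      by (auto simp: Z_def intro!: set_plus_intro dest!: subsetD[where c = "z + a + c"])
  qed
  \<comment> \<open>Only elements of \<open>X + A + {c}\<close> outside \<open>Z + A + {c}\<close>
    can be new. Both \<open>U\<close> and \<open>L\<close> are stated as sums because subtraction
    truncates on naturals.\<close>
  have U: "card (X + A + insert c C) + card (Z + A) \<le> card (X + A + C) + card (X + A)"
  proof -
    have "X + A + insert c C \<subseteq> (X + A + C) \<union> ((X + A + {c}) - (Z + A + {c}))"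
      using inZ unfolding ins set_plus_Un by blast
    then have "card (X + A + insert c C) \<le> card ((X + A + C) \<union> ((X + A + {c}) - (Z + A + {c})))"
      using fXAC fXAc by (intro card_mono) auto
    also have "\<dots> \<le> card (X + A + C) + card ((X + A + {c}) - (Z + A + {c}))"
      by (rule card_Un_le)
    also have "card ((X + A + {c}) - (Z + A + {c})) = card (X + A) - card (Z + A)"
      using sub1 fZAc by (simp add: card_Diff_subset card_plus_sing)
    finally show ?thesis
      using card_mono[OF fXAc sub1(1)] by (simp add: card_plus_sing)
  qed
  have L: "card (X + C) + card X \<le> card (X + insert c C) + card Z"
  proof -
    \<comment> \<open>Elements \<open>x + c\<close> outside \<open>Z + {c}\<close> are new: from
      \<open>x + c = x' + c'\<close> follows \<open>x + a + c = x' + a + c'\<close> for all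
      \<open>a\<close> in \<open>A\<close>, which puts \<open>x\<close> into
      \<open>Z\<close>.\<close>
    have disj: "(X + C) \<inter> ((X + {c}) - (Z + {c})) = {}"
    proof (rule ccontr)
      assume "\<not> ?thesis"
      then obtain y where y: "y \<in> X + C" "y \<in> X + {c}" "y \<notin> Z + {c}" by blast
      obtain x where "x \<in> X" "y = x + c" using y(2) by (auto elim: set_plus_elim)
      moreover obtain x' c' where "x' \<in> X" "c' \<in> C" "y = x' + c'"
        using y(1) by (rule set_plus_elim)
      ultimately have *: "x \<in> X" "x + c \<notin> Z + {c}" "x' \<in> X" "c' \<in> C" "x + c = x' + c'"
        using y(3) by simp_all
      have "{x} + A + {c} \<subseteq> X + A + C"
      proof
        fix y assume "y \<in> {x} + A + {c}"
        then obtain a where a: "a \<in> A" "y = x + a + c" by (auto simp: set_plus_def)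
        then have "y = x' + a + c'" using *(5) by (metis add.assoc add.commute)
        then show "y \<in> X + A + C" using * a(1) by (simp only:) (intro set_plus_intro)
      qed
      then have "x \<in> Z" using *(1) by (simp add: Z_def)
      then show False using *(2) by blast
    qed
    have "card (X + C) + (card X - card Z) = card (X + C) + card ((X + {c}) - (Z + {c}))"
      using sub1 fZc by (simp add: card_Diff_subset card_plus_sing)
    also have "\<dots> = card ((X + C) \<union> ((X + {c}) - (Z + {c})))"
      using disj fXC fXc by (subst card_Un_disjoint) auto
    also have "\<dots> \<le> card (X + insert c C)"
      using fXC fXc unfolding ins set_plus_Un by (intro card_mono) auto
    finally show ?thesis using card_mono[OF fin(1) ZX] by simp
  qed
  \<comment> \<open>With \<open>U\<close> scaled by |X| and \<open>L\<close> by |X + A|, the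
    leftover terms are |Z + A| |X| and |X + A| |Z|, which \<open>min\<close> compares.\<close>
  have "card (X + A + insert c C) * card X + card (Z + A) * card X
      \<le> card (X + A + C) * card X + card (X + A) * card X"
    using mult_right_mono[OF U, of "card X"] by (simp add: algebra_simps)
  moreover have "card (X + A) * card (X + C) + card (X + A) * card X
      \<le> card (X + A) * card (X + insert c C) + card (X + A) * card Z"
    using mult_left_mono[OF L, of "card (X + A)"] by (simp add: algebra_simps)
  ultimately show ?case using insert.IH min[OF ZX] by linarith
qed

text \<open>Take a nonempty \<open>X\<close> in \<open>B\<close> that minimises the ratio
  \<open>q\<close>. Petridis' inequality, with \<open>C\<close> an iterated sumset of
  \<open>A\<close>, shows that each further copy of \<open>A\<close> costs a factor of at most
  \<open>K = q X\<close>. As \<open>B\<close> itself competes in the minimum,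
  \<open>K \<le> q B\<close>.\<close>

lemma pluennecke_inequality:
  fixes A B :: "'a::ab_group_add set"
  assumes fin: "finite A" "finite B" and ne: "A \<noteq> {}" "B \<noteq> {}" and "d \<ge> 1"
  shows "card (\<Sum>j=1..d. A) * card B ^ (d - 1) \<le> card (A + B) ^ d"
proof -
  define q where "q Z = real (card (Z + A)) / real (card Z)" for Z
  \<comment> \<open>The empty set has to be excluded: \<open>q {}\<close> is 0 / 0, that is 0, and
    would be minimal.\<close>
  have "finite (Pow B - {{}})" "Pow B - {{}} \<noteq> {}" using fin ne by auto
  then obtain X where "is_arg_min q (\<lambda>X. X \<in> Pow B - {{}}) X"
    using ex_is_arg_min_if_finite by blast
  then have X: "X \<subseteq> B" "X \<noteq> {}" and qmin: "\<And>Z. Z \<subseteq> B \<Longrightarrow> Z \<noteq> {} \<Longrightarrow> q X \<le> q Z"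
    by (auto simp: is_arg_min_linorder)
  have finX: "finite X" using X fin finite_subset by blast
  have pos: "card Z > 0" if "Z \<subseteq> B" "Z \<noteq> {}" for Z
    using that fin finite_subset card_gt_0_iff by blast
  have min: "card (X + A) * card Z \<le> card (Z + A) * card X" if "Z \<subseteq> X" for Z
  proof (cases "Z = {}")
    case False
    have "q X \<le> q Z" using qmin that X False by blast
    then have "real (card (X + A) * card Z) \<le> real (card (Z + A) * card X)"
      using pos[OF X] pos[of Z] that X False by (simp add: q_def field_simps)
    then show ?thesis by (simp only: of_nat_le_iff)
  qed simp
  define K where "K = q X"
  have K0: "K \<ge> 0" by (simp add: K_def q_def)
  have growth: "real (card (X + (\<Sum>j=1..n. A))) \<le> K ^ n * real (card X)" for n :: nat
  proof (induction n)
    case 0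
    show ?case by simp
  next
    case (Suc n)
    let ?C = "\<Sum>j=1..n. A"
    have eq: "X + (\<Sum>j=1..Suc n. A) = X + A + ?C" by (simp add: ac_simps)
    have "finite ?C" using fin by (intro finite_set_sum)
    from petridis_inequality[OF finX fin(1) this min]
    have "real (card (X + A + ?C) * card X) \<le> real (card (X + A) * card (X + ?C))"
      by (simp only: of_nat_le_iff)
    then have "real (card (X + A + ?C)) \<le> K * real (card (X + ?C))"
      using pos[OF X] by (simp add: K_def q_def field_simps)
    also have "\<dots> \<le> K * (K ^ n * real (card X))"
      using Suc.IH K0 by (rule mult_left_mono)
    finally show ?case by (simp only: eq power_Suc mult.assoc)
  qed
  have "real (card (\<Sum>j=1..d. A)) \<le> real (card (X + (\<Sum>j=1..d. A)))"
    using card_le_card_set_plus[OF finX _ X(2)] finite_set_sum[of "{1..d}" "\<lambda>_. A"] fin by simp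
  also have "\<dots> \<le> K ^ d * real (card X)" by (rule growth)
  also have "\<dots> \<le> q B ^ d * real (card B)"
    using qmin[of B] ne X fin K0
    by (intro mult_mono power_mono) (auto simp: K_def card_mono)
  finally have "real (card (\<Sum>j=1..d. A)) * real (card B) ^ (d - 1)
      \<le> q B ^ d * real (card B) * real (card B) ^ (d - 1)"
    by (rule mult_right_mono) simp
  also have "\<dots> = (q B * real (card B)) ^ d"
    using \<open>d \<ge> 1\<close> by (cases d) (simp_all add: power_mult_distrib)
  also have "q B * real (card B) = real (card (A + B))"
    using pos[of B] ne by (simp add: q_def add.commute)
  finally have "real (card (\<Sum>j=1..d. A) * card B ^ (d - 1)) \<le> real (card (A + B) ^ d)"
    by simp
  then show ?thesis by (simp only: of_nat_le_iff)
qed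

section \<open>The Loomis--Whitney inequality\<close>

text \<open>Hoelder's inequality for \<open>card J\<close> functions with equal exponents, written
  without roots. Each \<open>f i\<close> is scaled to total 1, and the inequality of arithmetic and
  geometric means is applied at every point.\<close>

lemma sum_power_le_prod_sum:
  fixes u :: "'x \<Rightarrow> real" and f :: "'i \<Rightarrow> 'x \<Rightarrow> real"
  assumes fin: "finite J" "J \<noteq> {}" "finite X" and "C \<ge> 0"
    and u0: "\<And>x. x \<in> X \<Longrightarrow> u x \<ge> 0"
    and f0: "\<And>i x. i \<in> J \<Longrightarrow> x \<in> X \<Longrightarrow> f i x \<ge> 0"
    and le: "\<And>x. x \<in> X \<Longrightarrow> u x ^ card J \<le> C * (\<Prod>i\<in>J. f i x)"
  shows "(\<Sum>x\<in>X. u x) ^ card J \<le> C * (\<Prod>i\<in>J. \<Sum>x\<in>X. f i x)"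
proof -
  define m where "m = card J"
  have m: "m > 0" using fin by (simp add: m_def card_gt_0_iff)
  define F where "F i = (\<Sum>x\<in>X. f i x)" for i
  have F0: "F i \<ge> 0" if "i \<in> J" for i unfolding F_def using f0 that by (intro sum_nonneg)
  show ?thesis
  \<comment> \<open>A total \<open>F i = 0\<close> cannot be scaled to 1, but it forces
    \<open>f i\<close>, and with it \<open>u\<close>, to vanish on \<open>X\<close>.\<close>
  proof (cases "\<exists>i\<in>J. F i = 0")
    case True
    then obtain i where i: "i \<in> J" "F i = 0" by blast
    have "u x = 0" if x: "x \<in> X" for x
    proof -
      have "f i x = 0" using i x f0 fin by (simp add: F_def sum_nonneg_eq_0_iff)
      then have "(\<Prod>i\<in>J. f i x) = 0" using i fin by auto
      then have "u x ^ m \<le> 0" using le[OF x] by (simp add: m_def)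
      then show ?thesis
        using u0[OF x] m by (metis order_le_less not_less zero_less_power)
    qed
    then have "(\<Sum>x\<in>X. u x) ^ card J = 0" using m by (simp add: m_def)
    moreover have "0 \<le> C * (\<Prod>i\<in>J. F i)"
      using \<open>C \<ge> 0\<close> F0 by (simp add: prod_nonneg)
    ultimately show ?thesis by (simp only: F_def)
  next
    case False
    then have Fpos: "F i > 0" if "i \<in> J" for i using F0[OF that] that by force
    define P where "P = C * (\<Prod>i\<in>J. F i)"
    have P0: "P \<ge> 0" using \<open>C \<ge> 0\<close> F0 by (simp add: P_def prod_nonneg)
    define p where "p = P powr (1 / m)"
    have u_le: "u x \<le> p * (\<Sum>i\<in>J. f i x / F i / m)" if x: "x \<in> X" for x
    proof -
      have "u x = (u x ^ m) powr (1 / m)"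
        using u0[OF x] m by (cases "u x = 0") (simp_all add: powr_powr flip: powr_realpow)
      also have "\<dots> \<le> (C * (\<Prod>i\<in>J. f i x)) powr (1 / m)"
        using le[OF x] u0[OF x] by (intro powr_mono2) (auto simp: m_def)
      also have "C * (\<Prod>i\<in>J. f i x) = P * (\<Prod>i\<in>J. f i x / F i)"
        using Fpos fin(1) by (simp add: P_def prod_dividef) (metis less_irrefl)
      also have "\<dots> powr (1 / m) = p * (\<Prod>i\<in>J. f i x / F i) powr (1 / m)"
        using P0 f0 x F0 by (simp add: p_def powr_mult prod_nonneg)
      also have "\<dots> \<le> p * (\<Sum>i\<in>J. f i x / F i / m)"
        unfolding m_def using f0 x F0 fin
        by (intro mult_left_mono arith_geom_mean) (auto simp: p_def)
      finally show ?thesis .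
    qed
    have "(\<Sum>x\<in>X. u x) \<le> (\<Sum>x\<in>X. p * (\<Sum>i\<in>J. f i x / F i / m))"
      using u_le by (rule sum_mono)
    also have "\<dots> = p * (\<Sum>i\<in>J. \<Sum>x\<in>X. f i x / F i / m)"
      by (simp add: sum_distrib_left[symmetric] sum.swap[of _ J X])
    \<comment> \<open>This is where the scaling pays off: each \<open>f i\<close> divided by
      \<open>F i\<close> has total 1, so the bound collapses to \<open>p\<close>.\<close>
    also have "(\<Sum>i\<in>J. \<Sum>x\<in>X. f i x / F i / m) = (\<Sum>i\<in>J. 1 / m)"
    proof (rule sum.cong)
      fix i assume "i \<in> J"
      then show "(\<Sum>x\<in>X. f i x / F i / m) = 1 / m"
        using Fpos[of i] by (simp add: sum_divide_distrib[symmetric] F_def[symmetric])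
    qed simp
    also have "\<dots> = 1" using m by (simp add: m_def)
    finally have "(\<Sum>x\<in>X. u x) ^ m \<le> p ^ m"
      using u0 by (intro power_mono) (auto intro: sum_nonneg)
    also have "p ^ m = P"
      using P0 m by (cases "P = 0") (simp_all add: p_def powr_powr flip: powr_realpow)
    finally show ?thesis by (simp add: P_def F_def m_def)
  qed
qed

text \<open>Induction on \<open>I\<close>, cutting \<open>Y\<close> into slices along a new
  coordinate \<open>j\<close>. A slice embeds into the projection that forgets \<open>j\<close>, and
  the induction hypothesis bounds it by its own projections; Hoelder's inequality adds up the
  slices. Extensional functions are determined by their values on \<open>I\<close> and so serve as
  tuples.\<close>

lemma loomis_whitney_inequality:
  fixes Y :: "('i \<Rightarrow> 'a) set"
  assumes "finite I" "I \<noteq> {}" "finite Y" "Y \<noteq> {}" "Y \<subseteq> extensional I"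
  shows "card Y ^ (card I - 1) \<le> (\<Prod>i\<in>I. card ((\<lambda>a. restrict a (I - {i})) ` Y))"
  using assms
proof (induction I arbitrary: Y rule: finite_ne_induct)
  case (singleton i)
  \<comment> \<open>The left side is a zeroth power, hence 1, so a nonempty projection
    suffices.\<close>
  then have "(\<lambda>a. restrict a {}) ` Y \<noteq> {}" by blast
  then show ?case using singleton by (simp add: Suc_le_eq card_gt_0_iff)
next
  case (insert j J)
  define X where "X = (\<lambda>a. a j) ` Y"
  define S where "S x = {a \<in> Y. a j = x}" for x
  define T where "T x = (\<lambda>a. restrict a J) ` S x" for x
  define c where "c i x = card ((\<lambda>a. restrict a (J - {i})) ` S x)" for i x
  let ?\<pi> = "\<lambda>i. (\<lambda>a. restrict a (insert j J - {i})) ` Y"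
  have finX: "finite X" using insert.prems by (simp add: X_def)
  have finS: "finite (S x)" for x using insert.prems by (simp add: S_def)
  have Jj: "insert j J - {j} = J" using insert.hyps by auto
  have cardY: "card Y = (\<Sum>x\<in>X. card (S x))"
  proof -
    have "Y = (\<Union>x\<in>X. S x)" by (auto simp: X_def S_def)
    moreover have "card (\<Union>x\<in>X. S x) = (\<Sum>x\<in>X. card (S x))"
      using finX finS by (intro card_UN_disjoint) (auto simp: S_def)
    ultimately show ?thesis by simp
  qed
  \<comment> \<open>Coordinate \<open>j\<close> is constant on a slice, so forgetting it is
    injective there.\<close>
  have cardT: "card (T x) = card (S x)" for x
    unfolding T_def
  proof (intro card_image inj_onI)
    fix a b assume ab: "a \<in> S x" "b \<in> S x" "restrict a J = restrict b J"
    then have "a \<in> extensional (insert j J)" "b \<in> extensional (insert j J)" "a j = b j"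
      using insert.prems by (auto simp: S_def)
    moreover have "a i = b i" if "i \<in> J" for i
      using fun_cong[OF ab(3), of i] that by simp
    ultimately show "a = b" by (intro extensionalityI[of a "insert j J"]) auto
  qed
  have le: "card (S x) ^ card J \<le> card (?\<pi> j) * (\<Prod>i\<in>J. c i x)" if x: "x \<in> X" for x
  proof -
    have "T x \<subseteq> ?\<pi> j" unfolding Jj by (auto simp: T_def S_def)
    then have 1: "card (S x) \<le> card (?\<pi> j)"
      using insert.prems by (subst cardT[symmetric]) (auto intro: card_mono)
    have proj: "(\<lambda>a. restrict a (J - {i})) ` T x = (\<lambda>a. restrict a (J - {i})) ` S x" for i
      by (simp add: T_def image_image Int_absorb1 Int_absorb2 Diff_subset)
    have "finite (T x)" "T x \<noteq> {}" "T x \<subseteq> extensional J"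
      using finS x by (auto simp: T_def S_def X_def)
    from insert.IH[OF this]
    have 2: "card (S x) ^ (card J - 1) \<le> (\<Prod>i\<in>J. c i x)"
      unfolding proj cardT c_def[symmetric] .
    \<comment> \<open>One factor goes to the projection forgetting \<open>j\<close>, the others to
      the induction hypothesis.\<close>
    have "card (S x) ^ card J = card (S x) * card (S x) ^ (card J - 1)"
      using insert.hyps by (simp add: card_gt_0_iff power_eq_if)
    then show ?thesis using mult_mono[OF 1 2] by simp
  qed
  \<comment> \<open>As \<open>i \<noteq> j\<close>, forgetting \<open>i\<close> keeps coordinate
    \<open>j\<close>, so the images of distinct slices are disjoint and their sizes add up.
    Forgetting \<open>j\<close> as well can only shrink each image.\<close>
  have csum: "(\<Sum>x\<in>X. c i x) \<le> card (?\<pi> i)" if i: "i \<in> J" for i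
  proof -
    let ?D = "\<lambda>x. (\<lambda>a. restrict a (insert j J - {i})) ` S x"
    have ij: "i \<noteq> j" using i insert.hyps by auto
    have "c i x \<le> card (?D x)" for x
    proof -
      have "(\<lambda>a. restrict a (J - {i})) ` S x = (\<lambda>a. restrict a (J - {i})) ` ?D x"
        by (simp add: image_image Int_absorb1 insert_Diff_if subset_insertI2 ij)
      then show ?thesis
        unfolding c_def using finS by (metis card_image_le finite_imageI)
    qed
    then have "(\<Sum>x\<in>X. c i x) \<le> (\<Sum>x\<in>X. card (?D x))" by (rule sum_mono)
    also have "\<dots> = card (\<Union>x\<in>X. ?D x)"
    proof (rule card_UN_disjoint[symmetric, OF finX])
      show "\<forall>x\<in>X. finite (?D x)" using finS by blast
      have "x = y" if "b \<in> ?D x" "b \<in> ?D y" for b x y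
        using that ij by (auto simp: S_def dest!: fun_cong[where x = j])
      then show "\<forall>x\<in>X. \<forall>y\<in>X. x \<noteq> y \<longrightarrow> ?D x \<inter> ?D y = {}" by blast
    qed
    also have "\<dots> \<le> card (?\<pi> i)"
      using insert.prems by (intro card_mono) (auto simp: S_def)
    finally show ?thesis .
  qed
  have "real (card Y) ^ card J = (\<Sum>x\<in>X. real (card (S x))) ^ card J"
    by (simp add: cardY)
  also have "\<dots> \<le> real (card (?\<pi> j)) * (\<Prod>i\<in>J. \<Sum>x\<in>X. real (c i x))"
  proof (rule sum_power_le_prod_sum)
    fix x assume "x \<in> X"
    from le[OF this] have "real (card (S x) ^ card J) \<le> real (card (?\<pi> j) * (\<Prod>i\<in>J. c i x))"
      by (simp only: of_nat_le_iff)
    then show "real (card (S x)) ^ card J \<le> real (card (?\<pi> j)) * (\<Prod>i\<in>J. real (c i x))"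
      by simp
  qed (use insert.hyps finX in auto)
  also have "\<dots> = real (card (?\<pi> j) * (\<Prod>i\<in>J. \<Sum>x\<in>X. c i x))" by simp
  also have "\<dots> \<le> real (card (?\<pi> j) * (\<Prod>i\<in>J. card (?\<pi> i)))"
    using csum by (simp only: of_nat_le_iff) (intro mult_left_mono prod_mono, auto)
  also have "\<dots> = real (\<Prod>i\<in>insert j J. card (?\<pi> i))" using insert.hyps by simp
  finally have "card Y ^ card J \<le> (\<Prod>i\<in>insert j J. card (?\<pi> i))"
    by (simp only: of_nat_le_iff flip: of_nat_power)
  moreover have "card (insert j J) - 1 = card J" using insert.hyps by simp
  ultimately show ?case by (simp only:)
qed

section \<open>Submultiplicativity of sumsets\<close>

text \<open>
  Distinct tuples have distinct weights \<open>W\<close>, since binary expansions are unique. Weights are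
  additive over the coordinates, so deleting a coordinate from a representation of minimal weight
  leaves a representation of minimal weight.
\<close>

lemma card_sumset_power_le:
  fixes A :: "'i \<Rightarrow> 'a::ab_group_add set"
  assumes finI: "finite I" and neI: "I \<noteq> {}"
    and fin: "\<And>i. i \<in> I \<Longrightarrow> finite (A i)" and ne: "\<And>i. i \<in> I \<Longrightarrow> A i \<noteq> {}"
  shows "card (\<Sum>i\<in>I. A i) ^ (card I - 1) \<le> (\<Prod>i\<in>I. card (\<Sum>j\<in>I - {i}. A j))"
proof -
  have "finite (\<Union>i\<in>I. A i)" using finI fin by blast
  then obtain g :: "'a \<Rightarrow> nat" where g: "inj_on g (\<Union>i\<in>I. A i)"
    using finite_imp_inj_to_nat_seg by blast
  obtain h :: "'i \<Rightarrow> nat" where h: "inj_on h I"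
    using finite_imp_inj_to_nat_seg[OF finI] by blast
  \<comment> \<open>On indices in \<open>I\<close> and elements of the sets \<open>A i\<close>,
    \<open>k\<close> gives every pair its own bit. The binary digits of \<open>W J a\<close> then
    mark the pairs \<open>(i, a i)\<close> with \<open>i\<close> in \<open>J\<close>.\<close>
  define k where "k i x = prod_encode (h i, g x)" for i x
  define W where "W J a = (\<Sum>i\<in>J. 2 ^ k i (a i) :: nat)" for J a
  have W_inj: "restrict a J = restrict b J"
    if J: "J \<subseteq> I" and a: "\<And>i. i \<in> J \<Longrightarrow> a i \<in> A i" and b: "\<And>i. i \<in> J \<Longrightarrow> b i \<in> A i"
      and eq: "W J a = W J b" for J a b
  proof -
    have finJ: "finite J" using J finI finite_subset by blast
    have hJ: "inj_on h J" using h J by (rule inj_on_subset)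
    have enc: "W J c = set_encode ((\<lambda>i. k i (c i)) ` J)" for c
    proof -
      have "inj_on (\<lambda>i. k i (c i)) J"
        using hJ by (auto intro!: inj_onI simp: k_def dest: inj_onD)
      then show ?thesis by (simp add: W_def set_encode_def sum.reindex)
    qed
    have im: "(\<lambda>i. k i (a i)) ` J = (\<lambda>i. k i (b i)) ` J"
      using eq finJ by (simp add: enc set_encode_eq)
    show ?thesis
    proof (rule restrict_ext)
      fix i assume i: "i \<in> J"
      then obtain i' where i': "i' \<in> J" "k i (a i) = k i' (b i')" using im by blast
      then have "i = i'" using hJ i by (auto simp: k_def dest: inj_onD)
      moreover have "a i \<in> (\<Union>i\<in>I. A i)" "b i \<in> (\<Union>i\<in>I. A i)" using a b i J by blast+
      ultimately show "a i = b i" using i' g by (auto simp: k_def dest: inj_onD)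
    qed
  qed
  define Y where
    "Y = {a \<in> PiE I A. \<forall>b\<in>PiE I A. (\<Sum>i\<in>I. b i) = (\<Sum>i\<in>I. a i) \<longrightarrow> W I a \<le> W I b}"
  have finP: "finite (PiE I A)" using finI fin by (rule finite_PiE)
  then have finY: "finite Y" by (simp add: Y_def)
  have surj: "(\<Sum>i\<in>I. A i) \<subseteq> (\<lambda>a. \<Sum>i\<in>I. a i) ` Y"
  proof
    fix s assume "s \<in> (\<Sum>i\<in>I. A i)"
    then obtain a where a: "\<forall>i\<in>I. a i \<in> A i" "s = (\<Sum>i\<in>I. a i)"
      using finI by (auto simp: set_sum_alt)
    then have "restrict a I \<in> PiE I A \<and> (\<Sum>i\<in>I. restrict a I i) = s" by auto
    from ex_has_least_nat[of "\<lambda>a. a \<in> PiE I A \<and> (\<Sum>i\<in>I. a i) = s", OF this, of "W I"]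
    obtain b where b: "b \<in> PiE I A" "(\<Sum>i\<in>I. b i) = s"
      "\<And>c. c \<in> PiE I A \<Longrightarrow> (\<Sum>i\<in>I. c i) = s \<Longrightarrow> W I b \<le> W I c" by blast
    then have "b \<in> Y" by (simp add: Y_def)
    with b show "s \<in> (\<lambda>a. \<Sum>i\<in>I. a i) ` Y" by blast
  qed
  have neY: "Y \<noteq> {}" using surj set_sum_nonempty[of I A] ne by blast
  have proj: "card ((\<lambda>a. restrict a (I - {i})) ` Y) \<le> card (\<Sum>j\<in>I - {i}. A j)" if i: "i \<in> I" for i
  proof -
    let ?J = "I - {i}"
    have W_le: "W ?J b \<le> W ?J a"
      if ab: "a \<in> Y" "b \<in> Y" "(\<Sum>j\<in>?J. a j) = (\<Sum>j\<in>?J. b j)" for a b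
    proof -
      \<comment> \<open>Exchanging the entry of \<open>a\<close> at \<open>i\<close> for that of
        \<open>b\<close> gives another representation of the sum of \<open>b\<close>. Minimality of
        \<open>b\<close> compares their weights, and the common term at \<open>i\<close>
        cancels.\<close>
      define c where "c = a(i := b i)"
      have cJ: "c j = a j" if "j \<in> ?J" for j using that by (simp add: c_def)
      have "c \<in> PiE I A" using ab i by (auto simp: c_def Y_def PiE_iff extensional_def)
      moreover have "(\<Sum>j\<in>I. c j) = (\<Sum>j\<in>I. b j)"
        using ab(3) cJ by (simp add: sum.remove[OF finI i] c_def)
      ultimately have "W I b \<le> W I c" using ab(2) by (simp add: Y_def)
      then show ?thesis
        using cJ by (simp add: W_def sum.remove[OF finI i] c_def)
    qed
    have mem: "a j \<in> A j" if "a \<in> Y" "j \<in> I" for a j using that by (auto simp: Y_def)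
    \<comment> \<open>If the shortened sums agree, \<open>W_le\<close> used both ways makes the
      shortened weights equal, and \<open>W_inj\<close> identifies the projections.\<close>
    have inj: "inj_on (\<lambda>a. \<Sum>j\<in>?J. a j) ((\<lambda>a. restrict a ?J) ` Y)"
    proof (rule inj_onI, clarify)
      fix a b assume ab: "a \<in> Y" "b \<in> Y"
        and "(\<Sum>j\<in>?J. restrict a ?J j) = (\<Sum>j\<in>?J. restrict b ?J j)"
      then have "(\<Sum>j\<in>?J. a j) = (\<Sum>j\<in>?J. b j)" by simp
      with ab have "W ?J a = W ?J b" by (intro antisym W_le) auto
      then show "restrict a ?J = restrict b ?J" using ab mem by (intro W_inj) auto
    qed
    have "(\<lambda>a. \<Sum>j\<in>?J. a j) ` (\<lambda>a. restrict a ?J) ` Y \<subseteq> (\<Sum>j\<in>?J. A j)"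
      using finI mem by (auto simp: set_sum_alt)
    then show ?thesis
      using fin by (intro card_inj_on_le[OF inj]) (auto intro: finite_set_sum)
  qed
  have "card (\<Sum>i\<in>I. A i) \<le> card ((\<lambda>a. \<Sum>i\<in>I. a i) ` Y)"
    using surj finY by (intro card_mono) auto
  also have "\<dots> \<le> card Y" using finY by (rule card_image_le)
  finally have "card (\<Sum>i\<in>I. A i) ^ (card I - 1) \<le> card Y ^ (card I - 1)"
    by (rule power_mono) simp
  also have "\<dots> \<le> (\<Prod>i\<in>I. card ((\<lambda>a. restrict a (I - {i})) ` Y))"
    using finI neI finY neY by (intro loomis_whitney_inequality) (auto simp: Y_def PiE_def)
  also have "\<dots> \<le> (\<Prod>i\<in>I. card (\<Sum>j\<in>I - {i}. A j))"
    using proj by (intro prod_mono) auto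
  finally show ?thesis .
qed

section \<open>Combination of the two bounds\<close>

lemma prod_card_iterated_sumset_le:
  fixes A :: "nat \<Rightarrow> 'a::ab_group_add set"
  assumes "d \<ge> 1"
    and fin: "\<And>i. i \<in> {1..d} \<Longrightarrow> finite (A i)"
    and ne: "\<And>i. i \<in> {1..d} \<Longrightarrow> A i \<noteq> {}"
  shows "(\<Prod>i=1..d. card (\<Sum>j=1..d. A i)) \<le> card (\<Sum>i=1..d. A i) ^ (2 * d - 1)"
proof -
  let ?S = "\<Sum>i=1..d. A i" and ?B = "\<lambda>i. \<Sum>j\<in>{1..d} - {i}. A j"
  let ?P = "\<Prod>i=1..d. card (\<Sum>j=1..d. A i)"
  have pos: "card ?S > 0"
    using finite_set_sum[of "{1..d}" A] set_sum_nonempty[of "{1..d}" A] fin ne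
    by (simp add: card_gt_0_iff)
  have pl: "card (\<Sum>j=1..d. A i) * card (?B i) ^ (d - 1) \<le> card ?S ^ d" if i: "i \<in> {1..d}" for i
  proof -
    have "?S = A i + ?B i" using i by (intro sum.remove) auto
    moreover have "finite (?B i)" "?B i \<noteq> {}"
      using fin ne by (auto intro!: finite_set_sum set_sum_nonempty)
    ultimately show ?thesis using pluennecke_inequality[of "A i" "?B i" d] fin ne i \<open>d \<ge> 1\<close> by simp
  qed
  have "card ?S ^ (d - 1) \<le> (\<Prod>i=1..d. card (?B i))"
    using card_sumset_power_le[of "{1..d}" A] fin ne \<open>d \<ge> 1\<close> by simp
  \<comment> \<open>The power \<open>d - 1\<close> matches the exponent of
    \<open>card (?B i)\<close> in \<open>pl\<close>, so that \<open>pl\<close> can absorb these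
    factors.\<close>
  then have "(card ?S ^ (d - 1)) ^ (d - 1) \<le> (\<Prod>i=1..d. card (?B i)) ^ (d - 1)"
    by (rule power_mono) simp
  then have "?P * (card ?S ^ (d - 1)) ^ (d - 1) \<le> ?P * (\<Prod>i=1..d. card (?B i)) ^ (d - 1)"
    by (rule mult_left_mono) simp
  also have "\<dots> = (\<Prod>i=1..d. card (\<Sum>j=1..d. A i) * card (?B i) ^ (d - 1))"
    by (simp add: prod.distrib prod_power_distrib)
  also have "\<dots> \<le> (\<Prod>i=1..d. card ?S ^ d)"
    using pl by (intro prod_mono) auto
  also have "\<dots> = card ?S ^ (2 * d - 1) * (card ?S ^ (d - 1)) ^ (d - 1)"
  proof -
    \<comment> \<open>Splitting off \<open>(d - 1) * (d - 1)\<close> isolates the factor that also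
      stands on the left; it is positive and cancels.\<close>
    have "d * d = 2 * d - 1 + (d - 1) * (d - 1)"
      using \<open>d \<ge> 1\<close> by (cases d) simp_all
    then show ?thesis by (simp flip: power_mult power_add)
  qed
  finally show ?thesis using pos by simp
qed

theorem theorem1p5:
  fixes d :: nat and A :: "nat \<Rightarrow> 'a::ab_group_add set"
  assumes "d \<ge> 2"
    and "\<And>i. i \<in> {1..d} \<Longrightarrow> finite (A i)"
    and "\<And>i. i \<in> {1..d} \<Longrightarrow> A i \<noteq> {}"
  shows "real (card (\<Sum>i=1..d. A i))
           \<ge> (\<Prod>i=1..d. real (card (\<Sum>j=1..d. A i))) powr (1 / (2 * real d))"
proof -
  let ?S = "\<Sum>i=1..d. A i"
  have pos: "card ?S > 0"
    using finite_set_sum[of "{1..d}" A] set_sum_nonempty[of "{1..d}" A] assms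
    by (simp add: card_gt_0_iff)
  have "(\<Prod>i=1..d. card (\<Sum>j=1..d. A i)) \<le> card ?S ^ (2 * d - 1)"
    using assms by (intro prod_card_iterated_sumset_le) auto
  \<comment> \<open>Since \<open>card ?S\<close> is at least 1, the exponent may be raised to fit
    the root of order \<open>2 * d\<close>.\<close>
  also have "\<dots> \<le> card ?S ^ (2 * d)"
    using pos by (intro power_increasing) auto
  finally have "real (\<Prod>i=1..d. card (\<Sum>j=1..d. A i)) \<le> real (card ?S ^ (2 * d))"
    by (simp only: of_nat_le_iff)
  then have "(\<Prod>i=1..d. real (card (\<Sum>j=1..d. A i))) powr (1 / (2 * real d))
      \<le> (real (card ?S) ^ (2 * d)) powr (1 / (2 * real d))"
    by (intro powr_mono2) (auto intro: prod_nonneg)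
  also have "\<dots> = real (card ?S)"
    using pos assms(1) by (simp add: powr_powr flip: powr_realpow)
  finally show ?thesis .
qed

end
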